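(* Let $a$ be an integer and $n$ an integer with $\gcd(n,2a)=1$. Then $n$ is a strong Frobenius pseudoprime with respect to $x-a$ if and only if $n$ is a strong pseudoprime to the base $a$.
   Context: A strong pseudoprime to the base $a$ is an odd composite $n=2^rs+1$ with $s$ odd such that either $a^s\equiv 1\pmod n$ or $a^{2^ts}\equiv -1\pmod n$ for some integer $t$ with $0\le t<r$. For monic polynomials $g_1,g_2$ over a commutative ring $R$ with identity, a monic $h\in R[x]$ is $\operatorname{gcmd}(g_1,g_2)$ if the ideal generated by $g_1,g_2$ equals the ideal generated by $h$ (it may fail to exist). Let $f(x)\in\mathbb{Z}[x]$ be monic of degree $d$ with discriminant $\Delta$. An odd integer $n>1$ is a Frobenius probable prime with respect to $f$ if $\gcd(n,f(0)\Delta)=1$ and, with all computations in $(\mathbb{Z}/n\mathbb{Z})[x]$: (Factorization) setting $f_0=f\bmod n$ and, for $1\le i\le d$, $F_i=\operatorname{gcmd}(x^{n^i}-x,f_{i-1})$ and $f_i=f_{i-1}/F_i$, all these gcmds exist and $f_d=1$; (Frobenius) for $2\le i\le d$, $F_i(x^n)\equiv 0\pmod{F_i(x)}$; (Jacobi) with $S=\sum_{2\mid i}\deg(F_i)/i$, one has $(-1)^S=\left(\frac{\Delta}{n}\right)$ (Jacobi symbol). $n$ is a strong Frobenius probable prime with respect to $f$ if it is a Frobenius probable prime and moreover (Square Root Step) for each $1\le i\le d$, writing $n^i-1=2^rs$ with $s$ odd, the polynomials $F_{i,0}=\operatorname{gcmd}(F_i,x^s-1)$ and $F_{i,j}=\operatorname{gcmd}(F_i,x^{2^{j-1}s}+1)$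 for $1\le j\le r$ all exist, $F_i=\prod_{j=0}^rF_{i,j}$, and each $\deg F_{i,j}$ is a multiple of $i$. A strong Frobenius pseudoprime with respect to $f$ is a composite strong Frobenius probable prime with respect to $f$. *)

theory Defs
  imports
    "HOL-Algebra.UnivPoly"
    "HOL-Algebra.Divisibility"
    "HOL-Number_Theory.Number_Theory"
    "Subresultants.Resultant_Prelim"
begin

definition strong_pseudoprime :: "int \<Rightarrow> int \<Rightarrow> bool" where
  "strong_pseudoprime a n \<longleftrightarrow>
     odd n \<and> n > 1 \<and> \<not> prime n \<and>
     (\<exists>r s :: nat. odd s \<and> n = 2 ^ r * int s + 1 \<and>
        ([a ^ s = 1] (mod n) \<or> (\<exists>t<r. [a ^ (2 ^ t * s) = -1] (mod n))))"

(* For monic f, the product of the squared differences of the roots of f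
   equals (-1)^(d(d-1)/2) Res(f, f'), where d is the degree. *)
definition discriminant :: "int poly \<Rightarrow> int" where
  "discriminant f = (-1) ^ (degree f * (degree f - 1) div 2) * resultant f (pderiv f)"

definition Jacobi :: "int \<Rightarrow> int \<Rightarrow> int" where
  "Jacobi a n = (\<Prod>p\<in>#prime_factorization n. Legendre a p)"

definition monic_UP :: "('a, 'm) ring_scheme \<Rightarrow> (nat \<Rightarrow> 'a) \<Rightarrow> bool" where
  "monic_UP R h \<longleftrightarrow> h \<in> carrier (UP R) \<and> up_ring.coeff (UP R) h (deg R h) = \<one>\<^bsub>R\<^esub>"

definition is_gcmd ::
  "('a, 'm) ring_scheme \<Rightarrow> (nat \<Rightarrow> 'a) \<Rightarrow> (nat \<Rightarrow> 'a) \<Rightarrow> (nat \<Rightarrow> 'a) \<Rightarrow> bool" where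
  "is_gcmd R g\<^sub>1 g\<^sub>2 h \<longleftrightarrow>
     monic_UP R h \<and> Idl\<^bsub>UP R\<^esub> {g\<^sub>1, g\<^sub>2} = Idl\<^bsub>UP R\<^esub> {h}"

abbreviation Zmod :: "int \<Rightarrow> int ring" where
  "Zmod n \<equiv> residue_ring n"

abbreviation Zmod_poly :: "int \<Rightarrow> (int, nat \<Rightarrow> int) up_ring" where
  "Zmod_poly n \<equiv> UP (Zmod n)"

abbreviation X_pow :: "int \<Rightarrow> nat \<Rightarrow> nat \<Rightarrow> int" where
  "X_pow n k \<equiv> up_ring.monom (Zmod_poly n) \<one>\<^bsub>Zmod n\<^esub> k"

definition reduce_poly :: "int \<Rightarrow> int poly \<Rightarrow> nat \<Rightarrow> int" where
  "reduce_poly n f = (\<lambda>i. poly.coeff f i mod n)"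

(* The substitution F(x) -> F(x^k). *)
definition subst_X_pow :: "int \<Rightarrow> nat \<Rightarrow> (nat \<Rightarrow> int) \<Rightarrow> nat \<Rightarrow> int" where
  "subst_X_pow n k F =
     eval (Zmod n) (Zmod_poly n) (\<lambda>c. up_ring.monom (Zmod_poly n) c 0) (X_pow n k) F"

(* The Factorization Step produces F 1, ..., F d. As gcmds are unique and division by a
   monic polynomial is unambiguous, these polynomials (and the remaining factors
   g i, with g 0 the reduction of f) are determined by n and f; the values of F
   outside 1..d are irrelevant. *)
definition factorization_step :: "int \<Rightarrow> int poly \<Rightarrow> (nat \<Rightarrow> nat \<Rightarrow> int) \<Rightarrow> bool" where
  "factorization_step n f F \<longleftrightarrow>
     (\<exists>g. g 0 = reduce_poly n f \<and>
        (\<forall>i\<in>{1..degree f}.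
           is_gcmd (Zmod n) (X_pow n (nat n ^ i) \<ominus>\<^bsub>Zmod_poly n\<^esub> X_pow n 1) (g (i - 1)) (F i) \<and>
           g i \<in> carrier (Zmod_poly n) \<and>
           g (i - 1) = F i \<otimes>\<^bsub>Zmod_poly n\<^esub> g i) \<and>
        g (degree f) = \<one>\<^bsub>Zmod_poly n\<^esub>)"

definition frobenius_step :: "int \<Rightarrow> int poly \<Rightarrow> (nat \<Rightarrow> nat \<Rightarrow> int) \<Rightarrow> bool" where
  "frobenius_step n f F \<longleftrightarrow>
     (\<forall>i\<in>{2..degree f}. F i divides\<^bsub>Zmod_poly n\<^esub> subst_X_pow n (nat n) (F i))"

(* The exponent is a sum of fractions; it has to be an integer for (-1)^S to make sense. *)
definition jacobi_step :: "int \<Rightarrow> int poly \<Rightarrow> (nat \<Rightarrow> nat \<Rightarrow> int) \<Rightarrow> bool" where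
  "jacobi_step n f F \<longleftrightarrow>
     (\<exists>S :: nat.
        (of_nat S :: rat) =
          (\<Sum>i | i \<in> {1..degree f} \<and> even i. of_nat (deg (Zmod n) (F i)) / of_nat i) \<and>
        (-1) ^ S = Jacobi (discriminant f) n)"

definition square_root_step :: "int \<Rightarrow> int poly \<Rightarrow> (nat \<Rightarrow> nat \<Rightarrow> int) \<Rightarrow> bool" where
  "square_root_step n f F \<longleftrightarrow>
     (\<forall>i\<in>{1..degree f}. \<exists>(r :: nat) (s :: nat) G.
        odd s \<and> nat n ^ i = 2 ^ r * s + 1 \<and>
        is_gcmd (Zmod n) (F i) (X_pow n s \<ominus>\<^bsub>Zmod_poly n\<^esub> \<one>\<^bsub>Zmod_poly n\<^esub>) (G 0) \<and>
        (\<forall>j\<in>{1..r}.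
           is_gcmd (Zmod n) (F i)
             (X_pow n (2 ^ (j - 1) * s) \<oplus>\<^bsub>Zmod_poly n\<^esub> \<one>\<^bsub>Zmod_poly n\<^esub>) (G j)) \<and>
        F i = (\<Otimes>\<^bsub>Zmod_poly n\<^esub>j\<in>{0..r}. G j) \<and>
        (\<forall>j\<in>{0..r}. i dvd deg (Zmod n) (G j)))"

definition frobenius_probable_prime :: "int \<Rightarrow> int poly \<Rightarrow> bool" where
  "frobenius_probable_prime n f \<longleftrightarrow>
     lead_coeff f = 1 \<and> odd n \<and> n > 1 \<and> gcd n (poly f 0 * discriminant f) = 1 \<and>
     (\<exists>F. factorization_step n f F \<and> frobenius_step n f F \<and> jacobi_step n f F)"

definition strong_frobenius_probable_prime :: "int \<Rightarrow> int poly \<Rightarrow> bool" where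
  "strong_frobenius_probable_prime n f \<longleftrightarrow>
     frobenius_probable_prime n f \<and>
     (\<exists>F. factorization_step n f F \<and> square_root_step n f F)"

definition strong_frobenius_pseudoprime :: "int \<Rightarrow> int poly \<Rightarrow> bool" where
  "strong_frobenius_pseudoprime n f \<longleftrightarrow>
     \<not> prime n \<and> strong_frobenius_probable_prime n f"

end

theory Submission
  imports Defs
begin

text \<open>
  Over a nontrivial commutative ring, the gcmd of \<open>x - a\<close> and \<open>p\<close> is \<open>x - a\<close> if \<open>p(a) = 0\<close>,
  it is \<open>1\<close> if \<open>p(a)\<close> is a unit, and otherwise it does not exist. Hence the Factorization Step for
  \<open>x - a\<close> says that \<open>F\<^sub>1 = x - a\<close> and \<open>a\<^sup>n = a\<close> modulo \<open>n\<close>, and the Square Root Step says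
  that each of \<open>a\<^sup>s - 1\<close> and \<open>a^(2^t s) + 1\<close>, \<open>t < r\<close>, is zero or a unit modulo \<open>n\<close>,
  exactly one of them being zero. Among these numbers, an earlier one divides a later one
  minus 2; so for odd \<open>n\<close>, as soon as one vanishes modulo \<open>n\<close>, all the others are units.
\<close>

section \<open>Ideals with two generators\<close>

text \<open>The sum of the principal ideals of \<open>x\<close> and \<open>y\<close> is an ideal
  containing both generators, hence it contains the ideal they generate. The lemma supplies Bezout
  coefficients when a gcmd is 1.\<close>

lemma (in cring) Idl_pair_memE:
  assumes xy: "x \<in> carrier R" "y \<in> carrier R" and z: "z \<in> Idl {x, y}"
  obtains u v where "u \<in> carrier R" "v \<in> carrier R" "z = u \<otimes> x \<oplus> v \<otimes> y"
proof -
  have ids: "ideal (PIdl x) R" "ideal (PIdl y) R"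
    using xy by (auto intro: cgenideal_ideal)
  have mem: "z \<in> PIdl z" "\<zero> \<in> PIdl z" if "z \<in> carrier R" for z
    using that cgenideal_self[OF that] cgenideal_ideal[OF that]
      additive_subgroup.zero_closed ideal.axioms(1) by auto
  have add: "u \<oplus> v \<in> PIdl x <+>\<^bsub>R\<^esub> PIdl y" if "u \<in> PIdl x" "v \<in> PIdl y" for u v
    using that unfolding set_add_def' by blast
  have "x \<oplus> \<zero> \<in> PIdl x <+>\<^bsub>R\<^esub> PIdl y" "\<zero> \<oplus> y \<in> PIdl x <+>\<^bsub>R\<^esub> PIdl y"
    by (intro add mem xy)+
  then have "{x, y} \<subseteq> PIdl x <+>\<^bsub>R\<^esub> PIdl y"
    using xy by simp
  then have "Idl {x, y} \<subseteq> PIdl x <+>\<^bsub>R\<^esub> PIdl y"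
    by (intro genideal_minimal add_ideals ids)
  then show thesis
    using z that unfolding set_add_def' cgenideal_def by blast
qed

section \<open>Gcmds with a linear polynomial over a commutative ring\<close>

context UP_cring
begin

text \<open>In the convolution, every index other than \<open>deg R p\<close> puts one factor above
  its degree. Zero divisors may make the remaining product vanish, so this determines a coefficient
  and not yet the degree of the product.\<close>

lemma coeff_mult_deg_add:
  assumes "p \<in> carrier P" "q \<in> carrier P"
  shows "up_ring.coeff P (p \<otimes>\<^bsub>P\<^esub> q) (deg R p + deg R q) = lcoeff p \<otimes> lcoeff q"
proof -
  let ?d = "deg R p + deg R q"
  have "up_ring.coeff P (p \<otimes>\<^bsub>P\<^esub> q) ?d = (\<Oplus>i\<in>{..?d}. up_ring.coeff P p i \<otimes> up_ring.coeff P q (?d - i))"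
    using assms by simp
  also have "\<dots> = (\<Oplus>i\<in>{..?d}. if deg R p = i then up_ring.coeff P p i \<otimes> up_ring.coeff P q (?d - i) else \<zero>)"
  proof (intro R.finsum_cong')
    fix i assume "i \<in> {..?d}"
    show "up_ring.coeff P p i \<otimes> up_ring.coeff P q (?d - i)
        = (if deg R p = i then up_ring.coeff P p i \<otimes> up_ring.coeff P q (?d - i) else \<zero>)"
    proof (cases i "deg R p" rule: linorder_cases)
      case less
      then have "up_ring.coeff P q (?d - i) = \<zero>"
        using assms by (intro deg_aboveD) auto
      with less assms show ?thesis by simp
    next
      case greater
      then have "up_ring.coeff P p i = \<zero>"
        using assms by (intro deg_aboveD) auto
      with greater assms show ?thesis by simp
    qed auto
  qed (use assms in auto)
  also have "\<dots> = lcoeff p \<otimes> lcoeff q"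
    using assms by (subst R.finsum_singleton) auto
  finally show ?thesis .
qed

lemma monic_deg_0:
  assumes "monic_UP R h" "deg R h = 0"
  shows "h = \<one>\<^bsub>P\<^esub>"
proof -
  have h: "h \<in> carrier P" "up_ring.coeff P h 0 = \<one>"
    using assms unfolding monic_UP_def P_def by auto
  then show ?thesis
    using deg_zero_impl_monom[OF h(1) assms(2)] by simp
qed

abbreviation lin :: "'a \<Rightarrow> nat \<Rightarrow> 'a" where
  "lin a \<equiv> up_ring.monom P \<one> 1 \<ominus>\<^bsub>P\<^esub> up_ring.monom P a 0"

abbreviation eval_at :: "'a \<Rightarrow> (nat \<Rightarrow> 'a) \<Rightarrow> 'a" where
  "eval_at a \<equiv> eval R R id a"

lemma eval_id_ring_hom_cring:
  assumes "a \<in> carrier R"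
  shows "ring_hom_cring P R (eval_at a)"
proof -
  interpret E: UP_pre_univ_prop R R id P
    using UP_pre_univ_propI[OF R.is_cring R.is_cring id_ring_hom] unfolding P_def .
  show ?thesis
    using E.eval_ring_hom[OF assms] P.is_cring R.is_cring
    by (intro ring_hom_cringI)
qed

lemma eval_id_monom:
  assumes "a \<in> carrier R" "r \<in> carrier R"
  shows "eval_at a (up_ring.monom P r k) = r \<otimes> a [^] k"
proof -
  interpret E: UP_pre_univ_prop R R id P
    using UP_pre_univ_propI[OF R.is_cring R.is_cring id_ring_hom] unfolding P_def .
  show ?thesis
    using E.eval_monom assms by simp
qed

lemma linear_neq_one:
  assumes "a \<in> carrier R" "\<one> \<noteq> \<zero>"
  shows "lin a \<noteq> \<one>\<^bsub>P\<^esub>"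
  using deg_minus_monom[OF assms(1)] deg_one assms(2) R.one_closed by fastforce

lemma monic_linear:
  assumes "a \<in> carrier R" "\<one> \<noteq> \<zero>"
  shows "monic_UP R (lin a)"
  using lcoeff_monom[OF assms(1)] assms R.one_closed
  unfolding monic_UP_def P_def[symmetric] by fastforce

lemma monic_one: "monic_UP R \<one>\<^bsub>P\<^esub>"
  unfolding monic_UP_def P_def[symmetric] by simp

text \<open>Since \<open>h\<close> is monic, the top coefficient of \<open>k\<close> survives in the
  product, so the degrees of \<open>k\<close> and \<open>h\<close> add up to 1 even in the presence
  of zero divisors. Either \<open>h\<close> is then a monic constant, or \<open>k\<close> is a
  constant and comparing leading coefficients gives \<open>k = 1\<close>.\<close>

lemma monic_dvd_linear:
  assumes a: "a \<in> carrier R" and nontriv: "\<one> \<noteq> \<zero>"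
    and h: "monic_UP R h" and k: "k \<in> carrier P" and eq: "lin a = k \<otimes>\<^bsub>P\<^esub> h"
  shows "h = \<one>\<^bsub>P\<^esub> \<or> h = lin a"
proof -
  have nt: "carrier R \<noteq> {\<zero>}"
    using nontriv R.one_closed by blast
  have lP: "lin a \<in> carrier P"
    using a by simp
  have hP: "h \<in> carrier P" and lh: "lcoeff h = \<one>"
    using h unfolding monic_UP_def P_def by auto
  have co: "up_ring.coeff P (lin a) (deg R k + deg R h) = lcoeff k"
    using coeff_mult_deg_add[OF k hP] lh k eq by simp
  \<comment> \<open>A zero cofactor would make \<open>lin a\<close> zero, of degree 0 instead of
    1.\<close>
  have "k \<noteq> \<zero>\<^bsub>P\<^esub>"
    using eq hP deg_minus_monom[OF a nt] deg_zero by fastforce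
  then have "up_ring.coeff P (lin a) (deg R k + deg R h) \<noteq> \<zero>"
    using co k lcoeff_nonzero2 by simp
  then have "deg R k + deg R h \<le> 1"
    using deg_aboveD[OF _ lP] deg_minus_monom[OF a nt] by (metis not_less)
  moreover have "1 \<le> deg R k + deg R h"
    using deg_mult_ring[OF k hP] deg_minus_monom[OF a nt] eq by simp
  ultimately consider "deg R h = 0" | "deg R k = 0" "deg R h = 1"
    by linarith
  then show ?thesis
  proof cases
    case 1
    then show ?thesis using monic_deg_0[OF h] by blast
  next
    case 2
    then have "up_ring.coeff P k 0 = \<one>"
      using co lcoeff_monom[OF a nt] deg_minus_monom[OF a nt] by simp
    then have "k = \<one>\<^bsub>P\<^esub>"
      using deg_zero_impl_monom[OF k 2(1)] by simp
    then show ?thesis using eq hP by simp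
  qed
qed

text \<open>A gcmd is a monic divisor of \<open>lin a\<close>, so only \<open>lin a\<close> and 1
  are candidates. Evaluation at \<open>a\<close>, which kills \<open>lin a\<close>, tells which of
  them can occur; the remainder theorem gives the converse.\<close>

lemma is_gcmd_linear_iff:
  assumes a: "a \<in> carrier R" and nontriv: "\<one> \<noteq> \<zero>" and p: "p \<in> carrier P"
  shows "is_gcmd R (lin a) p h \<longleftrightarrow>
    eval_at a p = \<zero> \<and> h = lin a \<or> eval_at a p \<in> Units R \<and> h = \<one>\<^bsub>P\<^esub>"
proof -
  interpret E: ring_hom_cring P R "eval_at a"
    by (rule eval_id_ring_hom_cring[OF a])
  have nt: "carrier R \<noteq> {\<zero>}"
    using nontriv R.one_closed by blast
  have lP: "lin a \<in> carrier P"
    using a by simp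
  have ev0: "eval_at a (lin a) = \<zero>"
    by (rule eval_monom_expr[OF a])
  obtain q where q: "q \<in> carrier P" "p = lin a \<otimes>\<^bsub>P\<^esub> q \<oplus>\<^bsub>P\<^esub> up_ring.monom P (eval_at a p) 0"
    using remainder_theorem[OF p a nt] by blast
  have sub: "{lin a, p} \<subseteq> carrier P"
    using lP p by simp
  show ?thesis
  proof
    assume "is_gcmd R (lin a) p h"
    then have m: "monic_UP R h" and id: "Idl\<^bsub>P\<^esub> {lin a, p} = Idl\<^bsub>P\<^esub> {h}"
      unfolding is_gcmd_def P_def[symmetric] by auto
    have hP: "h \<in> carrier P"
      using m unfolding monic_UP_def P_def by auto
    have "lin a \<in> PIdl\<^bsub>P\<^esub> h" "p \<in> PIdl\<^bsub>P\<^esub> h"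
      using P.genideal_self[OF sub] id P.cgenideal_eq_genideal[OF hP] by auto
    then obtain k k' where k: "k \<in> carrier P" "lin a = k \<otimes>\<^bsub>P\<^esub> h"
      and k': "k' \<in> carrier P" "p = k' \<otimes>\<^bsub>P\<^esub> h"
      unfolding cgenideal_def by blast
    from monic_dvd_linear[OF a nontriv m k]
    show "eval_at a p = \<zero> \<and> h = lin a \<or> eval_at a p \<in> Units R \<and> h = \<one>\<^bsub>P\<^esub>"
    proof
      assume h: "h = lin a"
      then have "eval_at a p = eval_at a k' \<otimes> eval_at a (lin a)"
        using k' lP by (metis E.hom_mult)
      then show ?thesis
        using h ev0 k' by simp
    next
      assume h: "h = \<one>\<^bsub>P\<^esub>"
      then have "\<one>\<^bsub>P\<^esub> \<in> Idl\<^bsub>P\<^esub> {lin a, p}"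
        using id P.genideal_self'[OF hP] by simp
      then obtain u v where uv: "u \<in> carrier P" "v \<in> carrier P"
        "\<one>\<^bsub>P\<^esub> = u \<otimes>\<^bsub>P\<^esub> lin a \<oplus>\<^bsub>P\<^esub> v \<otimes>\<^bsub>P\<^esub> p"
        using P.Idl_pair_memE[OF lP p] by blast
      \<comment> \<open>Evaluating the Bezout relation at \<open>a\<close> exhibits the value of
        \<open>v\<close> as an inverse of the value of \<open>p\<close>.\<close>
      have "\<one> = eval_at a (u \<otimes>\<^bsub>P\<^esub> lin a \<oplus>\<^bsub>P\<^esub> v \<otimes>\<^bsub>P\<^esub> p)"
        using uv(3) E.hom_one by metis
      also have "\<dots> = eval_at a u \<otimes> eval_at a (lin a) \<oplus> eval_at a v \<otimes> eval_at a p"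
        using uv(1,2) lP p by (simp only: E.hom_add E.hom_mult P.m_closed)
      also have "\<dots> = eval_at a v \<otimes> eval_at a p"
        using uv(1,2) p ev0 by simp
      finally have "eval_at a v \<otimes> eval_at a p = \<one>" by simp
      then have "eval_at a p \<in> Units R"
        using uv(2) p R.m_comm[of "eval_at a v" "eval_at a p"] unfolding Units_def by fastforce
      then show ?thesis using h by simp
    qed
  next
    assume "eval_at a p = \<zero> \<and> h = lin a \<or> eval_at a p \<in> Units R \<and> h = \<one>\<^bsub>P\<^esub>"
    then show "is_gcmd R (lin a) p h"
    proof (elim disjE conjE)
      assume "eval_at a p = \<zero>" and h: "h = lin a"
      then have "p = q \<otimes>\<^bsub>P\<^esub> lin a"
        using q lP P.m_comm by simp
      then have "p \<in> Idl\<^bsub>P\<^esub> {lin a}"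
        using q(1) P.cgenideal_eq_genideal[OF lP] unfolding cgenideal_def by blast
      then have "Idl\<^bsub>P\<^esub> {lin a, p} \<subseteq> Idl\<^bsub>P\<^esub> {lin a}"
        using P.genideal_self'[OF lP] lP by (intro P.genideal_minimal P.genideal_ideal) auto
      moreover have "Idl\<^bsub>P\<^esub> {lin a} \<subseteq> Idl\<^bsub>P\<^esub> {lin a, p}"
        using P.genideal_self[OF sub] sub by (intro P.genideal_minimal P.genideal_ideal) auto
      ultimately show ?thesis
        using h monic_linear[OF a nontriv] unfolding is_gcmd_def P_def[symmetric] by blast
    next
      assume u: "eval_at a p \<in> Units R" and h: "h = \<one>\<^bsub>P\<^esub>"
      interpret I: ideal "Idl\<^bsub>P\<^esub> {lin a, p}" P
        using sub by (rule P.genideal_ideal)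
      \<comment> \<open>The constant \<open>?c\<close> is the remainder of \<open>p\<close> on
        division by \<open>lin a\<close>, hence a member of the ideal; multiplying by its inverse
        \<open>?d\<close> brings 1 into the ideal.\<close>
      let ?c = "up_ring.monom P (eval_at a p) 0" and ?d = "up_ring.monom P (inv eval_at a p) 0"
      have cP: "?c \<in> carrier P" and dP: "?d \<in> carrier P"
        using u by auto
      have "p \<ominus>\<^bsub>P\<^esub> lin a \<otimes>\<^bsub>P\<^esub> q \<in> Idl\<^bsub>P\<^esub> {lin a, p}"
        unfolding a_minus_def[of P p]
        using P.genideal_self[OF sub] q(1)
        by (intro additive_subgroup.a_closed[OF I.additive_subgroup_axioms]
            additive_subgroup.a_inv_closed[OF I.additive_subgroup_axioms] I.I_r_closed) auto
      moreover have "p \<ominus>\<^bsub>P\<^esub> lin a \<otimes>\<^bsub>P\<^esub> q = ?c"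
      proof -
        have "(m \<oplus>\<^bsub>P\<^esub> ?c) \<ominus>\<^bsub>P\<^esub> m = ?c" if "m \<in> carrier P" for m
        proof -
          have "(m \<oplus>\<^bsub>P\<^esub> ?c) \<ominus>\<^bsub>P\<^esub> m = ?c \<oplus>\<^bsub>P\<^esub> (m \<oplus>\<^bsub>P\<^esub> \<ominus>\<^bsub>P\<^esub> m)"
            unfolding a_minus_def[of P]
            by (simp only: P.a_comm[OF that cP] P.a_assoc[OF cP that P.a_inv_closed[OF that]])
          also have "\<dots> = ?c"
            by (simp only: P.r_neg[OF that] P.r_zero[OF cP])
          finally show ?thesis .
        qed
        from this[OF P.m_closed[OF lP q(1)]] show ?thesis
          using q(2) by metis
      qed
      ultimately have "?d \<otimes>\<^bsub>P\<^esub> ?c \<in> Idl\<^bsub>P\<^esub> {lin a, p}"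
        using dP I.I_l_closed by simp
      moreover have "?d \<otimes>\<^bsub>P\<^esub> ?c = \<one>\<^bsub>P\<^esub>"
        using monom_mult[of "inv eval_at a p" "eval_at a p" 0 0] u R.Units_closed[OF u]
        by (simp del: monom_mult)
      ultimately have "Idl\<^bsub>P\<^esub> {lin a, p} = Idl\<^bsub>P\<^esub> {h}"
        using h I.one_imp_carrier P.genideal_one by simp
      then show ?thesis
        using h monic_one unfolding is_gcmd_def P_def[symmetric] by blast
    qed
  qed
qed

end

text \<open>Elements of \<open>carrier (UP R)\<close> are themselves coefficient functions. This
  allows a pointwise comparison with \<open>reduce_poly\<close>, which is a plain function.\<close>

lemma coeff_UP_apply:
  assumes "p \<in> carrier (UP R)"
  shows "up_ring.coeff (UP R) p k = p k"
  using assms by (simp add: UP_def)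

section \<open>Divisibility among the values at \<open>a\<close>\<close>

lemma dvd_power_minus_one: "x - 1 dvd x ^ k - (1 :: int)"
  using power_diff_1_eq[of x k] by (cases k) auto

text \<open>The values at \<open>a\<close> of the polynomials whose gcmds with \<open>x - a\<close> are the
  \<open>F\<^sub>1\<^sub>,\<^sub>j\<close> of the Square Root Step.\<close>
definition sqrt_value :: "int \<Rightarrow> nat \<Rightarrow> nat \<Rightarrow> int" where
  "sqrt_value a s j = (if j = 0 then a ^ s - 1 else a ^ (2 ^ (j - 1) * s) + 1)"

text \<open>For \<open>i = 0\<close>, the power on the right is a power of \<open>a ^ s\<close>. For
  \<open>i = Suc m\<close> it is a power of \<open>x ^ 2\<close>, where
  \<open>x = a ^ (2 ^ m * s)\<close>, and \<open>x + 1\<close> divides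
  \<open>x ^ 2 - 1\<close>.\<close>

lemma sqrt_value_dvd_power_minus_one:
  assumes "i \<le> k"
  shows "sqrt_value a s i dvd a ^ (2 ^ k * s) - 1"
proof (cases i)
  case 0
  then show ?thesis
    using dvd_power_minus_one[of "a ^ s" "2 ^ k"]
    by (simp add: sqrt_value_def power_mult[symmetric] mult.commute)
next
  case (Suc m)
  define x where "x = a ^ (2 ^ m * s)"
  have "2 ^ k * s = 2 ^ m * s * (2 * 2 ^ (k - i))"
    using assms Suc power_add[of "2 :: nat" "Suc m" "k - i"] by simp
  then have "a ^ (2 ^ k * s) = (x ^ 2) ^ (2 ^ (k - i))"
    unfolding x_def by (simp only: power_mult[symmetric] mult.assoc)
  then have "x ^ 2 - 1 dvd a ^ (2 ^ k * s) - 1"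
    using dvd_power_minus_one[of "x ^ 2" "2 ^ (k - i)"] by simp
  moreover have "x + 1 dvd x ^ 2 - 1"
    using square_diff_one_factored[of x] by (simp add: power2_eq_square)
  ultimately show ?thesis
    using Suc by (simp add: sqrt_value_def x_def dvd_trans)
qed

text \<open>As \<open>j\<close> is positive, the right-hand side equals
  \<open>a ^ (2 ^ (j - 1) * s) - 1\<close>, and \<open>i \<le> j - 1\<close>.\<close>

lemma sqrt_value_dvd_sqrt_value_minus_2:
  assumes "i < j"
  shows "sqrt_value a s i dvd sqrt_value a s j - 2"
  using sqrt_value_dvd_power_minus_one[of i "j - 1" a s] assms
  by (simp add: sqrt_value_def)

text \<open>A common divisor of \<open>n\<close> and the value at \<open>j\<close> also divides the
  value at \<open>i\<close>. Of these two values, the one with smaller index divides the other minus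
  2, so the common divisor divides 2, while \<open>n\<close> is odd.\<close>

lemma coprime_sqrt_value:
  assumes "odd n" "n dvd sqrt_value a s i" "i \<noteq> j"
  shows "coprime (sqrt_value a s j) n"
proof (rule coprimeI)
  fix d assume d: "d dvd sqrt_value a s j" "d dvd n"
  then have di: "d dvd sqrt_value a s i"
    using assms(2) dvd_trans by blast
  have "d dvd 2"
  proof (cases "i < j")
    case True
    then have "d dvd sqrt_value a s j - 2"
      using sqrt_value_dvd_sqrt_value_minus_2 di dvd_trans by blast
    then have "d dvd sqrt_value a s j - (sqrt_value a s j - 2)"
      using d(1) dvd_diff by blast
    then show ?thesis by simp
  next
    case False
    then have "d dvd sqrt_value a s i - 2"
      using sqrt_value_dvd_sqrt_value_minus_2[of j i] assms(3) d dvd_trans by (meson linorder_neqE_nat)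
    then have "d dvd sqrt_value a s i - (sqrt_value a s i - 2)"
      using di dvd_diff by blast
    then show ?thesis by simp
  qed
  moreover have "coprime n 2"
    using assms(1) by simp
  ultimately show "is_unit d"
    using d(2) coprime_common_divisor by blast
qed

text \<open>Index 0 is the first alternative in the definition of a strong pseudoprime, and index
  \<open>Suc t\<close> is the second one at \<open>t\<close>.\<close>

lemma ex_dvd_sqrt_value_iff:
  "(\<exists>j\<le>r. n dvd sqrt_value a s j) \<longleftrightarrow>
    [a ^ s = 1] (mod n) \<or> (\<exists>t<r. [a ^ (2 ^ t * s) = -1] (mod n))"
proof -
  have "(\<exists>j\<le>r. n dvd sqrt_value a s j) \<longleftrightarrow>
    n dvd sqrt_value a s 0 \<or> (\<exists>t<r. n dvd sqrt_value a s (Suc t))"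
    by (metis Suc_le_eq Suc_le_D le0 not0_implies_Suc)
  then show ?thesis
    by (simp add: sqrt_value_def cong_iff_dvd_diff)
qed

section \<open>Discriminant and Jacobi symbol in degree 1\<close>

lemma discriminant_linear: "discriminant [:- a, 1:] = 1"
  by (simp add: discriminant_def pderiv_pCons)

lemma Jacobi_one:
  assumes "n > 0"
  shows "Jacobi 1 n = 1"
proof -
  have "Legendre 1 p = 1" if "p \<in># prime_factorization n" for p
  proof -
    have "prime p" using that by auto
    then have "\<not> [1 = 0] (mod p)"
      by (auto simp: cong_iff_dvd_diff dest: not_prime_unit)
    moreover have "QuadRes p 1"
      unfolding QuadRes_def by (intro exI[of _ 1]) simp
    ultimately show ?thesis by (simp add: Legendre_def)
  qed
  then show ?thesis
    unfolding Jacobi_def by (metis image_mset_cong prod_mset.neutral_const)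
qed

section \<open>The steps of the test for \<open>x - a\<close> over the integers modulo
  \<open>n\<close>\<close>

context
  fixes n :: int
  assumes n: "n > 1"
begin

interpretation residues n "Zmod n"
  using n by unfold_locales simp_all

interpretation P: UP_cring "Zmod n" "Zmod_poly n"
  by unfold_locales

lemma residue_one_neq_zero: "\<one>\<^bsub>Zmod n\<^esub> \<noteq> \<zero>\<^bsub>Zmod n\<^esub>"
  by (simp add: res_one_eq res_zero_eq)

lemma reduce_poly_linear: "reduce_poly n [:- a, 1:] = P.lin (a mod n)"
proof -
  have cl: "up_ring.monom (Zmod_poly n) \<one>\<^bsub>Zmod n\<^esub> 1 \<in> carrier (Zmod_poly n)"
    "up_ring.monom (Zmod_poly n) (a mod n) 0 \<in> carrier (Zmod_poly n)"
    "P.lin (a mod n) \<in> carrier (Zmod_poly n)"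
    by auto
  have "P.lin (a mod n) k = reduce_poly n [:- a, 1:] k" for k
  proof -
    have "P.lin (a mod n) k = up_ring.coeff (Zmod_poly n) (P.lin (a mod n)) k"
      by (rule coeff_UP_apply[OF cl(3), symmetric])
    also have "\<dots> = (if 1 = k then \<one>\<^bsub>Zmod n\<^esub> else \<zero>\<^bsub>Zmod n\<^esub>)
        \<ominus>\<^bsub>Zmod n\<^esub> (if 0 = k then a mod n else \<zero>\<^bsub>Zmod n\<^esub>)"
      by (simp only: P.coeff_minus[OF cl(1,2)] P.coeff_monom one_closed mod_in_carrier)
    also have "\<dots> = reduce_poly n [:- a, 1:] k"
      using n by (auto simp: reduce_poly_def a_minus_def res_add_eq res_neg_eq res_zero_eq
          res_one_eq mod_simps coeff_pCons split: nat.splits)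
    finally show ?thesis .
  qed
  then show ?thesis by auto
qed

lemma eval_X_pow: "P.eval_at (a mod n) (X_pow n k) = a ^ k mod n"
  using P.eval_id_monom[of "a mod n" "\<one>\<^bsub>Zmod n\<^esub>" k] by (simp add: pow_cong)

lemma eval_at_factorization:
  "P.eval_at (a mod n) (X_pow n k \<ominus>\<^bsub>Zmod_poly n\<^esub> X_pow n 1) = (a ^ k - a) mod n"
proof -
  interpret E: ring_hom_cring "Zmod_poly n" "Zmod n" "P.eval_at (a mod n)"
    by (rule P.eval_id_ring_hom_cring) simp
  show ?thesis
    by (simp only: a_minus_def E.hom_add E.hom_a_inv P.monom_closed one_closed P.a_inv_closed
        eval_X_pow power_one_right neg_cong add_cong) simp
qed

text \<open>One family over all indices merges the two gcmd clauses of
  \<open>square_root_step\<close> and runs parallel to \<open>sqrt_value\<close>.\<close>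

definition sqrt_poly :: "nat \<Rightarrow> nat \<Rightarrow> nat \<Rightarrow> int" where
  "sqrt_poly s j = (if j = 0 then X_pow n s \<ominus>\<^bsub>Zmod_poly n\<^esub> \<one>\<^bsub>Zmod_poly n\<^esub>
    else X_pow n (2 ^ (j - 1) * s) \<oplus>\<^bsub>Zmod_poly n\<^esub> \<one>\<^bsub>Zmod_poly n\<^esub>)"

lemma sqrt_poly_closed: "sqrt_poly s j \<in> carrier (Zmod_poly n)"
  by (simp add: sqrt_poly_def)

lemma eval_at_sqrt_poly:
  "P.eval_at (a mod n) (sqrt_poly s j) = sqrt_value a s j mod n"
proof -
  interpret E: ring_hom_cring "Zmod_poly n" "Zmod n" "P.eval_at (a mod n)"
    by (rule P.eval_id_ring_hom_cring) simp
  have one: "P.eval_at (a mod n) \<one>\<^bsub>Zmod_poly n\<^esub> = 1 mod n"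
    using E.hom_one one_cong by simp
  show ?thesis
    by (cases "j = 0")
      (simp_all only: sqrt_poly_def sqrt_value_def simp_thms if_True if_False a_minus_def E.hom_add
        E.hom_a_inv P.monom_closed one_closed P.P.a_inv_closed P.P.one_closed one eval_X_pow
        neg_cong add_cong, simp_all)
qed

text \<open>Units modulo \<open>n\<close> are the residues coprime to \<open>n\<close>, so the ring
  criterion becomes one on an integer representative \<open>v\<close> of the value at
  \<open>a\<close>.\<close>

lemma is_gcmd_linear_mod_iff:
  assumes "p \<in> carrier (Zmod_poly n)" "P.eval_at (a mod n) p = v mod n"
  shows "is_gcmd (Zmod n) (P.lin (a mod n)) p h \<longleftrightarrow>
    n dvd v \<and> h = P.lin (a mod n) \<or> coprime v n \<and> h = \<one>\<^bsub>Zmod_poly n\<^esub>"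
proof -
  have "v mod n \<in> Units (Zmod n) \<longleftrightarrow> coprime v n"
    using n mod_in_res_units[of v] by (auto simp: res_units_eq)
  moreover have "v mod n = \<zero>\<^bsub>Zmod n\<^esub> \<longleftrightarrow> n dvd v"
    by (simp add: res_zero_eq dvd_eq_mod_eq_0)
  ultimately show ?thesis
    using P.is_gcmd_linear_iff[OF _ residue_one_neq_zero assms(1), of "a mod n" h] assms(2)
    by simp
qed

text \<open>In degree 1 the final cofactor \<open>g 1\<close> must be 1, which forces
  \<open>F 1\<close> to be all of \<open>x - a\<close>. This is the gcmd exactly when
  \<open>x^n - x\<close> vanishes at \<open>a\<close>.\<close>

lemma factorization_step_linear_iff:
  "factorization_step n [:- a, 1:] F \<longleftrightarrow>
    F 1 = P.lin (a mod n) \<and> [a ^ nat n = a] (mod n)"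
proof -
  let ?l = "P.lin (a mod n)" and ?q = "X_pow n (nat n ^ 1) \<ominus>\<^bsub>Zmod_poly n\<^esub> X_pow n 1"
  have lP: "?l \<in> carrier (Zmod_poly n)"
    by simp
  have gcmd: "is_gcmd (Zmod n) ?q ?l ?l \<longleftrightarrow> [a ^ nat n = a] (mod n)"
  proof -
    \<comment> \<open>The two generators form an unordered set, so they may be exchanged to put the
      linear one first.\<close>
    have "is_gcmd (Zmod n) ?q ?l ?l \<longleftrightarrow> is_gcmd (Zmod n) ?l ?q ?l"
      by (simp only: is_gcmd_def insert_commute)
    also have "\<dots> \<longleftrightarrow> n dvd a ^ nat n - a"
      using is_gcmd_linear_mod_iff[OF _ eval_at_factorization[of a "nat n ^ 1"], of ?l]
        P.linear_neq_one[OF _ residue_one_neq_zero, of "a mod n"] by simp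
    finally show ?thesis by (simp add: cong_iff_dvd_diff)
  qed
  have step: "factorization_step n [:- a, 1:] F \<longleftrightarrow>
    (\<exists>g :: nat \<Rightarrow> nat \<Rightarrow> int. g 0 = ?l \<and> (is_gcmd (Zmod n) ?q (g 0) (F 1) \<and> g 1 \<in> carrier (Zmod_poly n) \<and>
      g 0 = F 1 \<otimes>\<^bsub>Zmod_poly n\<^esub> g 1) \<and> g 1 = \<one>\<^bsub>Zmod_poly n\<^esub>)"
    unfolding factorization_step_def reduce_poly_linear by simp
  show ?thesis
  proof
    assume "factorization_step n [:- a, 1:] F"
    then obtain g :: "nat \<Rightarrow> nat \<Rightarrow> int" where g: "g 0 = ?l" "is_gcmd (Zmod n) ?q (g 0) (F 1)"
      "g 0 = F 1 \<otimes>\<^bsub>Zmod_poly n\<^esub> g 1" "g 1 = \<one>\<^bsub>Zmod_poly n\<^esub>"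
      unfolding step by blast
    then have "F 1 \<in> carrier (Zmod_poly n)"
      unfolding is_gcmd_def monic_UP_def by blast
    then have "F 1 = ?l"
      using g P.P.r_one by metis
    then show "F 1 = ?l \<and> [a ^ nat n = a] (mod n)"
      using g gcmd by simp
  next
    assume F: "F 1 = ?l \<and> [a ^ nat n = a] (mod n)"
    define g where "g = (\<lambda>i :: nat. if i = 0 then ?l else \<one>\<^bsub>Zmod_poly n\<^esub>)"
    have g: "g 0 = ?l" "g 1 = \<one>\<^bsub>Zmod_poly n\<^esub>"
      by (simp_all add: g_def)
    have "is_gcmd (Zmod n) ?q (g 0) (F 1)"
      using F by (simp only: g gcmd)
    moreover have "g 0 = F 1 \<otimes>\<^bsub>Zmod_poly n\<^esub> g 1"
      by (simp only: g F P.P.r_one[OF lP])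
    moreover have "g 1 \<in> carrier (Zmod_poly n)"
      unfolding g by (rule P.P.one_closed)
    ultimately show "factorization_step n [:- a, 1:] F"
      unfolding step using g by blast
  qed
qed

text \<open>If no value vanishes modulo \<open>n\<close>, every existing gcmd is 1, and their
  product cannot be \<open>x - a\<close>. If one value vanishes, the others are coprime to
  \<open>n\<close>, so all gcmds exist and exactly one is \<open>x - a\<close>.\<close>

lemma square_root_step_linear_iff:
  assumes odd: "odd n" and F: "F 1 = P.lin (a mod n)"
  shows "square_root_step n [:- a, 1:] F \<longleftrightarrow>
    (\<exists>r s. odd s \<and> n = 2 ^ r * int s + 1 \<and> (\<exists>j\<le>r. n dvd sqrt_value a s j))"
proof -
  let ?l = "P.lin (a mod n)"
  have lP: "?l \<in> carrier (Zmod_poly n)"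
    by simp
  have neq: "?l \<noteq> \<one>\<^bsub>Zmod_poly n\<^esub>"
    by (intro P.linear_neq_one residue_one_neq_zero) simp
  have gcmd: "is_gcmd (Zmod n) ?l (sqrt_poly s j) h \<longleftrightarrow>
      n dvd sqrt_value a s j \<and> h = ?l \<or>
      coprime (sqrt_value a s j) n \<and> h = \<one>\<^bsub>Zmod_poly n\<^esub>" for s j h
    by (intro is_gcmd_linear_mod_iff sqrt_poly_closed eval_at_sqrt_poly)
  have n_eq: "nat n ^ 1 = 2 ^ r * s + 1 \<longleftrightarrow> n = 2 ^ r * int s + 1" for r s
    using n by (simp add: nat_eq_iff add.commute)
  \<comment> \<open>Degree 1 leaves only \<open>i = 1\<close>, where the degree condition reads
    \<open>1 dvd deg\<close>.\<close>
  have step: "square_root_step n [:- a, 1:] F \<longleftrightarrow>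
    (\<exists>r s G. odd s \<and> n = 2 ^ r * int s + 1 \<and>
      (\<forall>j\<le>r. is_gcmd (Zmod n) ?l (sqrt_poly s j) (G j)) \<and>
      ?l = (\<Otimes>\<^bsub>Zmod_poly n\<^esub>j\<in>{0..r}. G j))"
  proof -
    have "(\<forall>j\<le>r. is_gcmd (Zmod n) ?l (sqrt_poly s j) (G j)) \<longleftrightarrow>
      is_gcmd (Zmod n) ?l (X_pow n s \<ominus>\<^bsub>Zmod_poly n\<^esub> \<one>\<^bsub>Zmod_poly n\<^esub>) (G 0) \<and>
      (\<forall>j\<in>{1..r}. is_gcmd (Zmod n) ?l
        (X_pow n (2 ^ (j - 1) * s) \<oplus>\<^bsub>Zmod_poly n\<^esub> \<one>\<^bsub>Zmod_poly n\<^esub>) (G j))"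
      (is "?all \<longleftrightarrow> ?zero \<and> ?pos") for r s G
    proof -
      have "?all \<longleftrightarrow> is_gcmd (Zmod n) ?l (sqrt_poly s 0) (G 0) \<and>
          (\<forall>j\<in>{1..r}. is_gcmd (Zmod n) ?l (sqrt_poly s j) (G j))"
        by (metis One_nat_def Suc_leI atLeastAtMost_iff le0 neq0_conv)
      also have "\<dots> \<longleftrightarrow> ?zero \<and> ?pos"
        by (simp add: sqrt_poly_def cong: conj_cong)
      finally show ?thesis .
    qed
    then show ?thesis
      unfolding square_root_step_def by (simp add: n_eq[simplified] F[simplified] conj_assoc)
  qed
  show ?thesis
  proof
    assume "square_root_step n [:- a, 1:] F"
    then obtain r s G where rs: "odd s" "n = 2 ^ r * int s + 1"
      and G: "\<And>j. j \<le> r \<Longrightarrow> is_gcmd (Zmod n) ?l (sqrt_poly s j) (G j)"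
      and prod: "?l = (\<Otimes>\<^bsub>Zmod_poly n\<^esub>j\<in>{0..r}. G j)"
      unfolding step by blast
    have "\<exists>j\<le>r. n dvd sqrt_value a s j"
    proof (rule ccontr)
      assume "\<not> ?thesis"
      then have "G j = \<one>\<^bsub>Zmod_poly n\<^esub>" if "j \<in> {0..r}" for j
        using G[of j] that unfolding gcmd by auto
      then have "(\<Otimes>\<^bsub>Zmod_poly n\<^esub>j\<in>{0..r}. G j) = \<one>\<^bsub>Zmod_poly n\<^esub>"
        by (rule P.P.finprod_one_eqI)
      then show False using prod neq by simp
    qed
    with rs show "\<exists>r s. odd s \<and> n = 2 ^ r * int s + 1 \<and> (\<exists>j\<le>r. n dvd sqrt_value a s j)"
      by blast
  next
    assume "\<exists>r s. odd s \<and> n = 2 ^ r * int s + 1 \<and> (\<exists>j\<le>r. n dvd sqrt_value a s j)"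
    then obtain r s i where rs: "odd s" "n = 2 ^ r * int s + 1"
      and i: "i \<le> r" "n dvd sqrt_value a s i"
      by blast
    \<comment> \<open>The whole factor \<open>x - a\<close> sits at the index \<open>i\<close> of
      the vanishing value.\<close>
    define G where "G = (\<lambda>j. if i = j then ?l else \<one>\<^bsub>Zmod_poly n\<^esub>)"
    have "\<forall>j\<le>r. is_gcmd (Zmod n) ?l (sqrt_poly s j) (G j)"
      unfolding gcmd G_def using i(2) coprime_sqrt_value[OF odd i(2)] by auto
    moreover have "?l = (\<Otimes>\<^bsub>Zmod_poly n\<^esub>j\<in>{0..r}. G j)"
      unfolding G_def using i(1) lP by (intro P.P.finprod_singleton[symmetric]) auto
    ultimately show "square_root_step n [:- a, 1:] F"
      unfolding step using rs by blast
  qed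
qed

end

theorem theorem5p3:
  fixes a n :: int
  assumes "gcd n (2 * a) = 1"
  shows "strong_frobenius_pseudoprime n [:- a, 1:] \<longleftrightarrow> strong_pseudoprime a n"
proof (cases "n > 1")
  case False
  then show ?thesis
    by (simp add: strong_frobenius_pseudoprime_def strong_frobenius_probable_prime_def
        frobenius_probable_prime_def strong_pseudoprime_def)
next
  case True
  have "coprime n 2" "coprime n a"
    using assms by (simp_all add: coprime_iff_gcd_eq_1[symmetric])
  then have odd: "odd n" by simp
  have disc: "gcd n (poly [:- a, 1:] 0 * discriminant [:- a, 1:]) = 1"
    using \<open>coprime n a\<close> by (simp add: discriminant_linear coprime_iff_gcd_eq_1)
  let ?ex = "\<exists>r s. odd s \<and> n = 2 ^ r * int s + 1 \<and> (\<exists>j\<le>r. n dvd sqrt_value a s j)"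
  \<comment> \<open>In degree 1 the index range from 2 is empty and there is no even index. Hence
    \<open>S = 0\<close>, in agreement with the Jacobi symbol of the discriminant 1.\<close>
  have frob: "frobenius_step n [:- a, 1:] F" "jacobi_step n [:- a, 1:] F" for F
  proof -
    show "frobenius_step n [:- a, 1:] F"
      by (simp add: frobenius_step_def)
    have none: "{i. i \<in> {1..degree [:- a, 1:]} \<and> even i} = {}"
      by auto
    show "jacobi_step n [:- a, 1:] F"
      unfolding jacobi_step_def none discriminant_linear
      using True by (intro exI[of _ 0]) (simp add: Jacobi_one)
  qed
  \<comment> \<open>A vanishing value divides \<open>a ^ (2 ^ r * s) - 1\<close>, whose exponent is
    \<open>n - 1\<close>. The condition of the Factorization Step thus follows from that of the
    Square Root Step.\<close>
  have fermat: "[a ^ nat n = a] (mod n)" if ex: ?ex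
  proof -
    obtain r s j where rs: "n = 2 ^ r * int s + 1" and j: "j \<le> r" "n dvd sqrt_value a s j"
      using ex by blast
    have "n dvd a ^ (2 ^ r * s) - 1"
      using j sqrt_value_dvd_power_minus_one dvd_trans by blast
    then have "[a ^ (2 ^ r * s) * a = 1 * a] (mod n)"
      by (intro cong_mult cong_refl) (simp add: cong_iff_dvd_diff)
    moreover have "nat n = Suc (2 ^ r * s)"
      using rs by (simp add: nat_eq_iff)
    ultimately show ?thesis by (simp add: mult.commute)
  qed
  \<comment> \<open>The Factorization Step forces \<open>F 1\<close> to be \<open>x - a\<close>; the
    constant family serves as witness.\<close>
  define F where "F = (\<lambda>_ :: nat. X_pow n 1 \<ominus>\<^bsub>Zmod_poly n\<^esub> up_ring.monom (Zmod_poly n) (a mod n) 0)"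
  have "(\<exists>F. factorization_step n [:- a, 1:] F \<and> square_root_step n [:- a, 1:] F) \<longleftrightarrow> ?ex"
  proof
    assume "\<exists>F. factorization_step n [:- a, 1:] F \<and> square_root_step n [:- a, 1:] F"
    then obtain F' where F': "factorization_step n [:- a, 1:] F'" "square_root_step n [:- a, 1:] F'"
      by (elim exE conjE)
    have "F' 1 = X_pow n 1 \<ominus>\<^bsub>Zmod_poly n\<^esub> up_ring.monom (Zmod_poly n) (a mod n) 0"
      using F'(1) by (simp only: factorization_step_linear_iff[OF True])
    then show ?ex
      using F'(2) by (simp only: square_root_step_linear_iff[OF True odd])
  next
    assume ex: ?ex
    have "F 1 = X_pow n 1 \<ominus>\<^bsub>Zmod_poly n\<^esub> up_ring.monom (Zmod_poly n) (a mod n) 0"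
      by (simp only: F_def)
    then have "factorization_step n [:- a, 1:] F \<and> square_root_step n [:- a, 1:] F"
      using ex fermat[OF ex]
      by (simp only: factorization_step_linear_iff[OF True]
          square_root_step_linear_iff[OF True odd] simp_thms)
    then show "\<exists>F. factorization_step n [:- a, 1:] F \<and> square_root_step n [:- a, 1:] F"
      by (intro exI[of _ F])
  qed
  then have "strong_frobenius_pseudoprime n [:- a, 1:] \<longleftrightarrow> \<not> prime n \<and> ?ex"
    unfolding strong_frobenius_pseudoprime_def strong_frobenius_probable_prime_def
      frobenius_probable_prime_def
    using frob odd True disc by auto
  then show ?thesis
    unfolding strong_pseudoprime_def ex_dvd_sqrt_value_iff using odd True by simp
qed

end
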